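(* Let $\mathcal{A}=(a_{i_1i_2\cdots i_m})$ be an order $m$ dimension $n$ nonnegative weakly irreducible tensor. Then \[ \min_{x\in \mathbb{R}_{++}^n} \max_{\gamma\in C(G_{\mathcal{A}})}\Big(\prod_{i\in\gamma} \frac{(\mathcal{A}x^{m-1})_i}{x_i^{m-1}}\Big)^{\frac{1}{|\gamma|}}=\rho(\mathcal{A})=\max_{x\in \mathbb{R}_{++}^n} \min_{\gamma\in C(G_{\mathcal{A}})}\Big(\prod_{i\in\gamma} \frac{(\mathcal{A}x^{m-1})_i}{x_i^{m-1}}\Big)^{\frac{1}{|\gamma|}}. \]
   Context: $\mathbb{R}_{++}^n$ is the set of vectors in $\mathbb{R}^n$ with all entries positive. $(\mathcal{A}x^{m-1})_i=\sum_{i_2,\ldots,i_m=1}^n a_{ii_2\cdots i_m}x_{i_2}\cdots x_{i_m}$; $\lambda\in\mathbb{C}$ is an eigenvalue of $\mathcal{A}$ if $\mathcal{A}x^{m-1}=\lambda(x_1^{m-1},\ldots,x_n^{m-1})^{\mathrm T}$ for some nonzero $x\in\mathbb{C}^n$; $\rho(\mathcal{A})$ is the maximum modulus of eigenvalues. The digraph $G_{\mathcal{A}}$ has vertices $\{1,\ldots,n\}$ and an arc $(i,j)$ whenever $a_{ii_2\cdots i_m}\neq0$ for some $i_2,\ldots,i_m$ with $j\in\{i_2,\ldots,i_m\}$ (loops allowed); $\mathcal{A}$ is weakly irreducible if $G_{\mathcal{A}}$ is strongly connected. $C(G_{\mathcal{A}})$ is the set of circuits, i.e. directed closed paths $i_1\to\cdots\to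 i_p\to i_1$ with $i_1,\ldots,i_p$ distinct (loops allowed); $|\gamma|=p$ and $\prod_{i\in\gamma}$ is the product over $i_1,\ldots,i_p$. *)

theory Defs
  imports "HOL-Analysis.Analysis" "Graph_Theory.Graph_Theory"
begin

text \<open>
  A tensor of order \<open>m\<close> and dimension \<open>CARD('n)\<close> is a function \<open>A :: 'n list \<Rightarrow> 'a\<close>, the entry
  $a_{i_1 \ldots i_m}$ being \<open>A [i\<^sub>1, \<dots>, i\<^sub>m]\<close>. Only the values on lists of length \<open>m\<close> matter.
\<close>

definition nonneg_tensor :: "nat \<Rightarrow> ('n list \<Rightarrow> real) \<Rightarrow> bool" where
  "nonneg_tensor m A \<longleftrightarrow> (\<forall>is. length is = m \<longrightarrow> 0 \<le> A is)"

text \<open>The vector $\mathcal{A} x^{m-1}$; the list \<open>js\<close> stands for $(i_2, \ldots, i_m)$.\<close>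

definition tensor_apply ::
    "nat \<Rightarrow> ('n::finite list \<Rightarrow> 'a::comm_semiring_1) \<Rightarrow> 'a ^ 'n \<Rightarrow> 'a ^ 'n" where
  "tensor_apply m A x = (\<chi> i. \<Sum>js | length js = m - 1. A (i # js) * (\<Prod>j\<leftarrow>js. x $ j))"

definition tensor_eigenvalue :: "nat \<Rightarrow> ('n::finite list \<Rightarrow> real) \<Rightarrow> complex \<Rightarrow> bool" where
  "tensor_eigenvalue m A \<mu> \<longleftrightarrow>
     (\<exists>x :: complex ^ 'n. x \<noteq> 0 \<and>
        tensor_apply m (\<lambda>is. complex_of_real (A is)) x = (\<chi> i. \<mu> * (x $ i) ^ (m - 1)))"

text \<open>
  The maximum modulus of the eigenvalues. \<open>GREATEST\<close> rather than \<open>Max\<close>, so that finiteness of the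
  set of eigenvalues is not presupposed.
\<close>

definition tensor_spectral_radius :: "nat \<Rightarrow> ('n::finite list \<Rightarrow> real) \<Rightarrow> real" where
  "tensor_spectral_radius m A = (GREATEST r. \<exists>\<mu>. tensor_eigenvalue m A \<mu> \<and> r = cmod \<mu>)"

definition tensor_digraph :: "nat \<Rightarrow> ('n list \<Rightarrow> real) \<Rightarrow> 'n pair_pre_digraph" where
  "tensor_digraph m A =
     \<lparr> pverts = UNIV,
       parcs = {(i, j). \<exists>js. length js = m - 1 \<and> A (i # js) \<noteq> 0 \<and> j \<in> set js} \<rparr>"

definition weakly_irreducible :: "nat \<Rightarrow> ('n list \<Rightarrow> real) \<Rightarrow> bool" where
  "weakly_irreducible m A \<longleftrightarrow> strongly_connected (with_proj (tensor_digraph m A))"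

text \<open>
  A circuit is the list of its arcs, with a chosen first arc; loops are allowed. The rotations of a
  circuit are distinct lists, but have the same length and the same vertices.
\<close>

definition tensor_circuits :: "nat \<Rightarrow> ('n list \<Rightarrow> real) \<Rightarrow> ('n \<times> 'n) list set" where
  "tensor_circuits m A = {\<gamma>. pre_digraph.cycle (with_proj (tensor_digraph m A)) \<gamma>}"

text \<open>
  The geometric mean of $(\mathcal{A} x^{m-1})_i / x_i^{m-1}$ over the vertices \<open>i\<close> of \<open>\<gamma>\<close>. Each
  vertex is the tail of exactly one arc of \<open>\<gamma>\<close>, and \<open>length \<gamma>\<close> is the number of vertices.
\<close>

definition circuit_mean ::
    "nat \<Rightarrow> ('n::finite list \<Rightarrow> real) \<Rightarrow> real ^ 'n \<Rightarrow> ('n \<times> 'n) list \<Rightarrow> real" where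
  "circuit_mean m A x \<gamma> =
     root (length \<gamma>) (\<Prod>(i, j)\<leftarrow>\<gamma>. tensor_apply m A x $ i / (x $ i) ^ (m - 1))"

definition positive_vectors :: "(real ^ 'n) set" where
  "positive_vectors = {x. \<forall>i. 0 < x $ i}"

definition is_minimum :: "real set \<Rightarrow> real \<Rightarrow> bool" where
  "is_minimum S v \<longleftrightarrow> v \<in> S \<and> (\<forall>w\<in>S. v \<le> w)"

definition is_maximum :: "real set \<Rightarrow> real \<Rightarrow> bool" where
  "is_maximum S v \<longleftrightarrow> v \<in> S \<and> (\<forall>w\<in>S. w \<le> v)"

lemma pair_fin_digraph_tensor_digraph:
  "pair_fin_digraph (tensor_digraph m (A :: 'n::finite list \<Rightarrow> real))"
  by unfold_locales (simp_all add: tensor_digraph_def)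

text \<open>Hence \<open>Max\<close> and \<open>Min\<close> over the circuits are meaningful as soon as a circuit exists.\<close>

lemma finite_tensor_circuits:
  "finite (tensor_circuits m (A :: 'n::finite list \<Rightarrow> real))"
proof -
  interpret pair_fin_digraph "tensor_digraph m A"
    by (rule pair_fin_digraph_tensor_digraph)
  have "tensor_circuits m A \<subseteq> {\<gamma>. set \<gamma> \<subseteq> UNIV \<and> distinct \<gamma>}"
    using cycle_conv by (auto simp: tensor_circuits_def)
  moreover have "finite {\<gamma> :: ('n \<times> 'n) list. set \<gamma> \<subseteq> UNIV \<and> distinct \<gamma>}"
    by (rule finite_subset_distinct) simp
  ultimately show ?thesis
    by (rule finite_subset)
qed

text \<open>
  So the only weakly irreducible tensors without circuits are those of dimension one without a
  loop, i.e. the zero tensor (when \<open>m \<ge> 2\<close>).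
\<close>

lemma tensor_circuits_nonempty:
  fixes A :: "'n::finite list \<Rightarrow> real"
  assumes "weakly_irreducible m A" and "CARD('n) \<ge> 2"
  shows "tensor_circuits m A \<noteq> {}"
proof -
  interpret pair_fin_digraph "tensor_digraph m A"
    by (rule pair_fin_digraph_tensor_digraph)
  obtain i j :: 'n where ij: "i \<noteq> j"
    using assms(2) by (metis UNIV_I card_2_iff' card_le_Suc0_iff_eq finite not_less_eq_eq numeral_2_eq_2)
  have V: "pverts (tensor_digraph m A) = UNIV"
    by (simp add: tensor_digraph_def)
  have R: "u \<rightarrow>\<^sup>*\<^bsub>with_proj (tensor_digraph m A)\<^esub> v" for u v
    using assms(1) V by (simp add: weakly_irreducible_def strongly_connected_def)
  obtain p where p: "awalk i p j"
    using R[of i j] reachable_awalk by blast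
  obtain q where q: "awalk j q i"
    using R[of j i] reachable_awalk by blast
  have "p \<noteq> []"
    using p ij awalk_Nil_iff by fastforce
  then have "closed_w (p @ q)"
    using awalk_appendI[OF p q] by (auto simp: closed_w_def)
  then show ?thesis
    using closed_w_imp_cycle by (auto simp: tensor_circuits_def)
qed

end

theory Submission
  imports Defs
begin

text \<open>Write (Ax)_i for the i-th entry of \<open>tensor_apply m A x\<close> and call (Ax)_i /
  x_i^(m-1) the ratio of x at i. Everything rests on a positive eigenvector u, all of whose ratios
  equal one number l >= 0 (\<open>positive_eigenvector\<close>). Every circuit mean of u is then l,
  so l occurs both among the maxima and among the minima. Comparing the moduli of a complex
  eigenvector with u shows that no eigenvalue exceeds l in modulus, so l is the spectral radius
  (\<open>tensor_spectral_radius_eq\<close>).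

  It remains to find, for any positive x, a circuit of mean at least l and one of mean at most l
  (\<open>circuit_mean_around_eigenvalue\<close>). Put t_i = u_i / x_i and choose for each i the
  out-neighbour j with the largest t_j. Only out-neighbours of i enter (Au)_i, so l u_i^(m-1) =
  (Au)_i <= t_j^(m-1) (Ax)_i, that is, l is at most the ratio of x at i times (t_j / t_i)^(m-1).
  Following the chosen arcs in a finite set runs into a circuit
  (\<open>circuit_along_function\<close>), around which the factors t_j / t_i multiply to 1
  (\<open>circuit_prod_telescope\<close>); hence its mean is at least l. Smallest instead of largest
  t_j gives the other bound.

  The eigenvector comes from minimizing the largest ratio over positive x. Normalized to least
  coordinate 1, the competing vectors are bounded by weak irreducibility
  (\<open>tensor_sublevel_bounded\<close>), so compactness yields a minimizer
  (\<open>tensor_minimax_attained\<close>); a minimizer attaining the largest ratio at the fewest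
  indices attains it at all of them.\<close>

section \<open>Products over lists\<close>

lemma prod_list_map_mono:
  fixes f g :: "'b \<Rightarrow> 'a::linordered_semidom"
  assumes "\<And>j. j \<in> set js \<Longrightarrow> 0 \<le> f j \<and> f j \<le> g j"
  shows "0 \<le> (\<Prod>j\<leftarrow>js. f j) \<and> (\<Prod>j\<leftarrow>js. f j) \<le> (\<Prod>j\<leftarrow>js. g j)"
  using assms
proof (induction js)
  case (Cons k js)
  then have "0 \<le> (\<Prod>j\<leftarrow>js. f j) \<and> (\<Prod>j\<leftarrow>js. f j) \<le> (\<Prod>j\<leftarrow>js. g j)" "0 \<le> f k" "f k \<le> g k"
    by simp_all
  then show ?case
    by (auto intro!: mult_mono order_trans[of 0 "f k" "g k"])
qed simp

lemma prod_list_map_pos: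
  fixes f :: "'b \<Rightarrow> 'a::linordered_semidom"
  assumes "\<And>j. j \<in> set js \<Longrightarrow> 0 < f j"
  shows "0 < (\<Prod>j\<leftarrow>js. f j)"
  using assms by (induction js) auto

lemma prod_list_map_strict_mono:
  fixes f g :: "'b \<Rightarrow> 'a::linordered_semidom"
  assumes "\<And>j. 0 < f j" "\<And>j. f j \<le> g j" "k \<in> set js" "f k < g k"
  shows "(\<Prod>j\<leftarrow>js. f j) < (\<Prod>j\<leftarrow>js. g j)"
  using assms(3)
proof (induction js)
  case (Cons l js)
  have p: "0 < (\<Prod>j\<leftarrow>js. f j)"
    by (intro prod_list_map_pos assms)
  have le: "(\<Prod>j\<leftarrow>js. f j) \<le> (\<Prod>j\<leftarrow>js. g j)"
    using prod_list_map_mono[of js f g] assms(1,2) by (auto intro: less_imp_le)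
  show ?case
  proof (cases "l = k")
    case True
    then show ?thesis
      using assms(1,4) p le by (auto intro!: mult_less_le_imp_less less_imp_le)
  next
    case False
    then have "(\<Prod>j\<leftarrow>js. f j) < (\<Prod>j\<leftarrow>js. g j)"
      using Cons by simp
    then show ?thesis
      using assms(1,2)[of l] p by (simp add: mult_le_less_imp_less)
  qed
qed simp

lemma prod_list_map_mult:
  fixes f g :: "'b \<Rightarrow> 'a::comm_monoid_mult"
  shows "(\<Prod>j\<leftarrow>js. f j * g j) = (\<Prod>j\<leftarrow>js. f j) * (\<Prod>j\<leftarrow>js. g j)"
  by (induction js) (simp_all add: ac_simps)

lemma prod_list_map_power:
  fixes f :: "'b \<Rightarrow> 'a::comm_monoid_mult"
  shows "(\<Prod>j\<leftarrow>js. f j ^ n) = (\<Prod>j\<leftarrow>js. f j) ^ n"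
  by (induction js) (simp_all add: power_mult_distrib)

lemma prod_list_map_const: "(\<Prod>j\<leftarrow>js. c) = (c :: 'a::comm_monoid_mult) ^ length js"
  by (induction js) simp_all

lemma member_le_prod_list:
  fixes f :: "'b \<Rightarrow> 'a::linordered_semidom"
  assumes "\<And>j. 1 \<le> f j" "k \<in> set js"
  shows "f k \<le> (\<Prod>j\<leftarrow>js. f j)"
  using assms(2)
proof (induction js)
  case (Cons l js)
  have p: "1 \<le> (\<Prod>j\<leftarrow>js. f j)"
    using prod_list_map_mono[of js "\<lambda>_. 1" f] assms(1) by (simp add: prod_list_map_const)
  show ?case
  proof (cases "l = k")
    case True
    have "f k * 1 \<le> f k * (\<Prod>j\<leftarrow>js. f j)"
      using p assms(1)[of k] by (intro mult_left_mono) (auto intro: order_trans[OF zero_le_one])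
    with True show ?thesis
      by simp
  next
    case False
    then have "f k \<le> (\<Prod>j\<leftarrow>js. f j)"
      using Cons by simp
    then have "1 * f k \<le> f l * (\<Prod>j\<leftarrow>js. f j)"
      using assms(1) by (intro mult_mono) (auto intro: order_trans[OF zero_le_one])
    then show ?thesis
      by simp
  qed
qed simp

section \<open>Order and continuity properties of the tensor map\<close>

lemma finite_lists_of_length: "finite {js :: 'n::finite list. length js = k}"
  using finite_lists_length_eq[of "UNIV :: 'n set" k] by simp

lemma tensor_apply_nonneg:
  fixes A :: "'n::finite list \<Rightarrow> real"
  assumes "m \<ge> 2" "nonneg_tensor m A" "\<And>j. 0 \<le> x $ j"
  shows "0 \<le> tensor_apply m A x $ i"
  using assms prod_list_map_mono[of _ "\<lambda>j. x $ j" "\<lambda>j. x $ j"]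
  by (auto simp: tensor_apply_def nonneg_tensor_def intro!: sum_nonneg mult_nonneg_nonneg)

text \<open>Homogeneity of degree m - 1 lets the scalars be moved inside the products. A coordinate
  that is not the head of an arc out of \<open>i\<close> occurs only with coefficient 0, so
  comparing the out-neighbours suffices; this is what makes a choice among out-neighbours useful
  later.\<close>

lemma tensor_apply_le:
  fixes A :: "'n::finite list \<Rightarrow> real"
  assumes "m \<ge> 2" "nonneg_tensor m A"
    and "\<And>j. (i, j) \<in> parcs (tensor_digraph m A) \<Longrightarrow> 0 \<le> r * x $ j \<and> r * x $ j \<le> s * y $ j"
  shows "r ^ (m - 1) * tensor_apply m A x $ i \<le> s ^ (m - 1) * tensor_apply m A y $ i"
proof -
  have "r ^ (m - 1) * (A (i # js) * (\<Prod>j\<leftarrow>js. x $ j)) \<le> s ^ (m - 1) * (A (i # js) * (\<Prod>j\<leftarrow>js. y $ j))"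
    if js: "length js = m - 1" for js
  proof (cases "A (i # js) = 0")
    case False
    have "(\<Prod>j\<leftarrow>js. r * x $ j) \<le> (\<Prod>j\<leftarrow>js. s * y $ j)"
      using assms(3) False js by (intro conjunct2[OF prod_list_map_mono]) (auto simp: tensor_digraph_def)
    then have "r ^ (m - 1) * (\<Prod>j\<leftarrow>js. x $ j) \<le> s ^ (m - 1) * (\<Prod>j\<leftarrow>js. y $ j)"
      using js by (simp add: prod_list_map_mult prod_list_map_const)
    moreover have "0 \<le> A (i # js)"
      using assms(1,2) js by (simp add: nonneg_tensor_def)
    ultimately show ?thesis
      using mult_left_mono by (fastforce simp: mult.left_commute)
  qed simp
  then show ?thesis
    by (auto simp: tensor_apply_def sum_distrib_left intro!: sum_mono)
qed

lemma tensor_apply_strict_mono: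
  fixes A :: "'n::finite list \<Rightarrow> real"
  assumes "m \<ge> 2" "nonneg_tensor m A" "(i, k) \<in> parcs (tensor_digraph m A)"
    and "\<And>j. 0 < x $ j" "\<And>j. x $ j \<le> y $ j" "x $ k < y $ k"
  shows "tensor_apply m A x $ i < tensor_apply m A y $ i"
proof -
  obtain ks where ks: "length ks = m - 1" "A (i # ks) \<noteq> 0" "k \<in> set ks"
    using assms(3) by (auto simp: tensor_digraph_def)
  have nn: "0 \<le> A (i # js)" if "length js = m - 1" for js
    using assms(1,2) that by (simp add: nonneg_tensor_def)
  have "A (i # ks) * (\<Prod>j\<leftarrow>ks. x $ j) < A (i # ks) * (\<Prod>j\<leftarrow>ks. y $ j)"
    using nn[OF ks(1)] ks prod_list_map_strict_mono[of "\<lambda>j. x $ j" "\<lambda>j. y $ j" k ks] assms(4-6)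
    by simp
  moreover have "A (i # js) * (\<Prod>j\<leftarrow>js. x $ j) \<le> A (i # js) * (\<Prod>j\<leftarrow>js. y $ j)"
    if "length js = m - 1" for js
    using nn[OF that] assms(4,5)
    by (intro mult_left_mono conjunct2[OF prod_list_map_mono]) (auto simp: less_imp_le)
  ultimately show ?thesis
    using ks(1) finite_lists_of_length
    by (auto simp: tensor_apply_def intro!: sum_strict_mono_ex1)
qed

text \<open>A single nonzero entry witnessing the arc suffices: the other factors of its monomial
  are at least 1 and all other terms are nonnegative.\<close>

lemma tensor_apply_arc_ge:
  fixes A :: "'n::finite list \<Rightarrow> real"
  assumes "m \<ge> 2" "nonneg_tensor m A" "(i, k) \<in> parcs (tensor_digraph m A)"
  obtains a where "0 < a" "\<And>x. (\<And>j. 1 \<le> x $ j) \<Longrightarrow> a * x $ k \<le> tensor_apply m A x $ i"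
proof -
  obtain ks where ks: "length ks = m - 1" "A (i # ks) \<noteq> 0" "k \<in> set ks"
    using assms(3) by (auto simp: tensor_digraph_def)
  have nn: "0 \<le> A (i # js)" if "length js = m - 1" for js
    using assms(1,2) that by (simp add: nonneg_tensor_def)
  have "A (i # ks) * x $ k \<le> tensor_apply m A x $ i" if x: "\<And>j. 1 \<le> x $ j" for x
  proof -
    have x0: "0 \<le> x $ j" for j
      using x[of j] by linarith
    have "A (i # ks) * x $ k \<le> A (i # ks) * (\<Prod>j\<leftarrow>ks. x $ j)"
      using nn ks x by (intro mult_left_mono member_le_prod_list) auto
    also have "\<dots> \<le> tensor_apply m A x $ i"
      unfolding tensor_apply_def vec_lambda_beta
      using ks(1) nn x0 finite_lists_of_length prod_list_map_mono[of _ "\<lambda>j. x $ j" "\<lambda>j. x $ j"]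
      by (intro member_le_sum[where f = "\<lambda>js. A (i # js) * (\<Prod>j\<leftarrow>js. x $ j)"]) auto
    finally show ?thesis .
  qed
  moreover have "0 < A (i # ks)"
    using nn ks by (simp add: order_less_le)
  ultimately show ?thesis
    using that by blast
qed

lemma continuous_on_tensor_apply [continuous_intros]:
  fixes A :: "'n::finite list \<Rightarrow> real"
  assumes "continuous_on S f"
  shows "continuous_on S (\<lambda>x. tensor_apply m A (f x) $ i)"
proof -
  have "continuous_on S (\<lambda>x. \<Prod>j\<leftarrow>js. f x $ j)" for js
    by (induction js) (auto intro!: continuous_intros assms)
  then show ?thesis
    by (auto simp: tensor_apply_def intro!: continuous_intros)
qed

section \<open>Weak irreducibility and the attained minimax value\<close>

text \<open>The form in which strong connectivity is used throughout: induction along a path from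
  \<open>i\<close>.\<close>

lemma weakly_irreducible_closed:
  assumes "weakly_irreducible m A" "i \<in> S"
    and "\<And>i j. i \<in> S \<Longrightarrow> (i, j) \<in> parcs (tensor_digraph m A) \<Longrightarrow> j \<in> S"
  shows "S = UNIV"
proof -
  interpret wf_digraph "with_proj (tensor_digraph m A)"
    by unfold_locales (simp_all add: tensor_digraph_def)
  have "j \<in> S" for j
  proof -
    have "i \<rightarrow>\<^sup>*\<^bsub>with_proj (tensor_digraph m A)\<^esub> j"
      using assms(1) by (auto simp: weakly_irreducible_def strongly_connected_def tensor_digraph_def)
    then show ?thesis
      by (induction rule: reachable_induct) (use assms in auto)
  qed
  then show ?thesis
    by blast
qed

text \<open>Bounds spread along arcs from the vertex \<open>k\<close>, where the coordinate is 1: if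
  x_i <= C and (i, j) is an arc, then a x_j <= (Ax)_i <= c x_i^(m-1) <= c C^(m-1) with a > 0
  independent of x. Finally the maximum over the finitely many pairs (k, i) gives one
  constant.\<close>

lemma tensor_sublevel_bounded:
  fixes A :: "'n::finite list \<Rightarrow> real"
  assumes "m \<ge> 2" "nonneg_tensor m A" "weakly_irreducible m A" "0 \<le> c"
  obtains K where "\<And>x k i. (\<And>j. 1 \<le> x $ j) \<Longrightarrow> x $ k = 1
    \<Longrightarrow> (\<And>j. tensor_apply m A x $ j \<le> c * (x $ j) ^ (m - 1)) \<Longrightarrow> x $ i \<le> K"
proof -
  define X where "X k = {x. (\<forall>j. 1 \<le> x $ j) \<and> x $ k = 1
    \<and> (\<forall>j. tensor_apply m A x $ j \<le> c * (x $ j) ^ (m - 1))}" for k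
  have "{i. \<exists>C. \<forall>x\<in>X k. x $ i \<le> C} = UNIV" for k
  proof (rule weakly_irreducible_closed[OF assms(3)])
    show "k \<in> {i. \<exists>C. \<forall>x\<in>X k. x $ i \<le> C}"
      by (auto simp: X_def)
  next
    fix i j
    assume "i \<in> {i. \<exists>C. \<forall>x\<in>X k. x $ i \<le> C}" and arc: "(i, j) \<in> parcs (tensor_digraph m A)"
    then obtain C where C: "\<forall>x\<in>X k. x $ i \<le> C"
      by auto
    obtain a where a: "0 < a" "\<And>x. (\<And>j. 1 \<le> x $ j) \<Longrightarrow> a * x $ j \<le> tensor_apply m A x $ i"
      using tensor_apply_arc_ge[OF assms(1,2) arc] by blast
    have "x $ j \<le> c * C ^ (m - 1) / a" if x: "x \<in> X k" for x
    proof -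
      have "0 \<le> x $ i"
        using x by (auto simp: X_def intro: order_trans[OF zero_le_one])
      have "a * x $ j \<le> c * (x $ i) ^ (m - 1)"
        using a(2)[of x] x by (auto simp: X_def intro: order_trans)
      also have "\<dots> \<le> c * C ^ (m - 1)"
        using \<open>0 \<le> x $ i\<close> C x assms(4) by (intro mult_left_mono power_mono) auto
      finally show ?thesis
        using a(1) by (simp add: field_simps)
    qed
    then show "j \<in> {i. \<exists>C. \<forall>x\<in>X k. x $ i \<le> C}"
      by blast
  qed
  then have "\<exists>C. \<forall>x\<in>X k. x $ i \<le> C" for k i
    by blast
  then obtain C where C: "\<And>k i x. x \<in> X k \<Longrightarrow> x $ i \<le> C k i"
    by metis
  have "x $ i \<le> Max (range (\<lambda>(k, i). C k i))" if "x \<in> X k" for x k i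
  proof -
    have "C k i \<le> Max (range (\<lambda>(k, i). C k i))"
      by (rule Max_ge) (auto intro: rev_image_eqI[of "(k, i)"])
    then show ?thesis
      using C[OF that, of i] by linarith
  qed
  then show ?thesis
    using that unfolding X_def by blast
qed

text \<open>The Collatz-Wielandt value: \<open>l\<close> is the least possible largest ratio. Its
  minimality is stated as the impossibility of having all ratios strictly below
  \<open>l\<close>.\<close>

lemma tensor_minimax_attained:
  fixes A :: "'n::finite list \<Rightarrow> real"
  assumes "m \<ge> 2" "nonneg_tensor m A" "weakly_irreducible m A"
  obtains l x where "0 \<le> l" "x \<in> positive_vectors"
    "\<And>i. tensor_apply m A x $ i \<le> l * (x $ i) ^ (m - 1)"
    "\<And>y. y \<in> positive_vectors \<Longrightarrow> \<exists>i. l * (y $ i) ^ (m - 1) \<le> tensor_apply m A y $ i"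
proof -
  \<comment> \<open>A crude bound for the ratios of the all-ones vector, so that values above
    \<open>c\<close> need not be considered.\<close>
  define c where "c = (\<Sum>i\<in>UNIV. tensor_apply m A 1 $ i)"
  have A1: "0 \<le> tensor_apply m A 1 $ i" for i
    using tensor_apply_nonneg[OF assms(1,2)] by simp
  have c: "0 \<le> c" "tensor_apply m A 1 $ i \<le> c" for i
    unfolding c_def using A1 by (auto intro!: sum_nonneg member_le_sum)
  obtain K where K: "\<And>x k i. (\<And>j. 1 \<le> x $ j) \<Longrightarrow> x $ k = 1
      \<Longrightarrow> (\<And>j. tensor_apply m A x $ j \<le> c * (x $ j) ^ (m - 1)) \<Longrightarrow> x $ i \<le> K"
    using tensor_sublevel_bounded[OF assms c(1)] by blast
  \<comment> \<open>The minimax problem in epigraph form: pairs of a value and a vector whose ratios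
    it bounds, so that the linear function \<open>fst\<close> is minimized over a compact
    set.\<close>
  define Q where "Q = cbox (0, 1) (c, \<chi> i. K) \<inter>
     {p :: real \<times> (real ^ 'n). \<forall>i. tensor_apply m A (snd p) $ i \<le> fst p * (snd p $ i) ^ (m - 1)}"
  have "compact Q"
    unfolding Q_def
    by (intro compact_Int_closed compact_cbox closed_Collect_all
        closed_Collect_le continuous_intros)
  have "(c, 1) \<in> Q"
    using c K[of 1] by (auto simp: Q_def cbox_Pair_eq mem_box_cart)
  have "continuous_on Q fst"
    by (intro continuous_intros)
  then obtain p where p: "p \<in> Q" "\<And>q. q \<in> Q \<Longrightarrow> fst p \<le> fst q"
    using continuous_attains_inf[OF \<open>compact Q\<close>, of fst] \<open>(c, 1) \<in> Q\<close> by blast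
  define l x where "l = fst p" "x = snd p"
  have "(l, x) \<in> Q" and least: "\<And>l' y. (l', y) \<in> Q \<Longrightarrow> l \<le> l'"
    using p by (force simp: l_x_def)+
  then have lx: "0 \<le> l" "l \<le> c" "\<And>i. 1 \<le> x $ i" "\<And>i. tensor_apply m A x $ i \<le> l * (x $ i) ^ (m - 1)"
    by (auto simp: Q_def cbox_Pair_eq mem_box_cart)
  have "\<exists>i. l * (y $ i) ^ (m - 1) \<le> tensor_apply m A y $ i" if "y \<in> positive_vectors" for y
  \<comment> \<open>Rescaling such a \<open>y\<close> to least coordinate 1 leaves its ratios
    unchanged; their maximum \<open>l'\<close> would then be the first component of a point of
    \<open>Q\<close> below \<open>l\<close>.\<close>
  proof (rule ccontr)
    assume "\<not> ?thesis"
    then have less: "tensor_apply m A y $ i < l * (y $ i) ^ (m - 1)" for i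
      by (simp add: not_le)
    have y: "0 < y $ i" for i
      using that by (simp add: positive_vectors_def)
    obtain k where k: "\<And>i. y $ k \<le> y $ i"
      using ex_is_arg_min_if_finite[of UNIV "\<lambda>i. y $ i"] by (auto simp: is_arg_min_linorder)
    define z where "z = (\<chi> i. y $ i / y $ k)"
    have z: "\<And>i. 1 \<le> z $ i" "z $ k = 1"
      using k y[of k] by (auto simp: z_def)
    have z0: "0 < z $ i" for i
      using z(1)[of i] by linarith
    have zless: "tensor_apply m A z $ i < l * (z $ i) ^ (m - 1)" for i
    proof -
      have "(y $ k) ^ (m - 1) * tensor_apply m A z $ i \<le> 1 ^ (m - 1) * tensor_apply m A y $ i"
        using y less_imp_neq[OF y[of k]]
        by (intro tensor_apply_le[OF assms(1,2)]) (auto simp: z_def intro: less_imp_le)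
      also have "\<dots> < l * (y $ i) ^ (m - 1)"
        using less by simp
      also have "\<dots> = (y $ k) ^ (m - 1) * (l * (z $ i) ^ (m - 1))"
        using y[of k] by (simp add: z_def power_divide)
      finally show ?thesis
        using y[of k] by (simp add: mult_less_cancel_left_pos)
    qed
    define l' where "l' = Max (range (\<lambda>i. tensor_apply m A z $ i / (z $ i) ^ (m - 1)))"
    have le: "tensor_apply m A z $ i / (z $ i) ^ (m - 1) \<le> l'" for i
      unfolding l'_def by (rule Max_ge) auto
    have "l' < l"
      unfolding l'_def using zless z0 by (subst Max_less_iff) (auto simp: pos_divide_less_eq)
    moreover have "0 \<le> l'"
      using le[of k] tensor_apply_nonneg[OF assms(1,2), of z k] z0
      by (auto intro: order_trans[rotated] less_imp_le simp: z)
    moreover have zle: "tensor_apply m A z $ i \<le> l' * (z $ i) ^ (m - 1)" for i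
      using le[of i] z0[of i] by (simp add: pos_divide_le_eq)
    \<comment> \<open>The bound \<open>K\<close> applies because the ratios of \<open>z\<close> are
      below \<open>l\<close>, hence below \<open>c\<close>.\<close>
    moreover have "z $ i \<le> K" for i
    proof (rule K[of z k])
      fix j
      show "tensor_apply m A z $ j \<le> c * (z $ j) ^ (m - 1)"
        using zless[of j] lx(2) z0[of j] by (smt (verit) mult_right_mono zero_less_power)
    qed (use z in auto)
    ultimately have "(l', z) \<in> Q"
      using lx(2) z by (auto simp: Q_def cbox_Pair_eq mem_box_cart)
    then show False
      using least \<open>l' < l\<close> by fastforce
  qed
  moreover have "x \<in> positive_vectors"
    using lx(3) by (auto simp: positive_vectors_def intro: less_le_trans[OF zero_less_one])
  ultimately show ?thesis
    using that lx by blast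
qed

section \<open>The positive eigenvector\<close>

text \<open>Strict inequality is an open condition on the single coordinate \<open>x $ j\<close>, so
  it survives a small decrease.\<close>

lemma decrease_coordinate:
  fixes A :: "'n::finite list \<Rightarrow> real"
  assumes "x \<in> positive_vectors" "tensor_apply m A x $ j < l * (x $ j) ^ (m - 1)"
  obtains y where "y \<in> positive_vectors" "y $ j < x $ j" "\<And>k. k \<noteq> j \<Longrightarrow> y $ k = x $ k"
    "tensor_apply m A y $ j < l * (y $ j) ^ (m - 1)"
proof -
  define g where "g s = (\<chi> k. if k = j then s else x $ k)" for s
  have g: "continuous_on UNIV g"
    unfolding g_def
  proof (intro continuous_on_vec_lambda)
    fix k
    show "continuous_on UNIV (\<lambda>s. if k = j then s else x $ k)"
      by (cases "k = j") (auto intro: continuous_intros)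
  qed
  have gx: "g (x $ j) = x"
    by (simp add: g_def vec_eq_iff)
  have "open {s. tensor_apply m A (g s) $ j < l * (g s $ j) ^ (m - 1)}"
    by (intro open_Collect_less continuous_intros g)
  moreover have "x $ j \<in> {s. tensor_apply m A (g s) $ j < l * (g s $ j) ^ (m - 1)}"
    using assms(2) gx by simp
  ultimately obtain e where e: "0 < e"
      "\<And>s. dist s (x $ j) < e \<Longrightarrow> tensor_apply m A (g s) $ j < l * (g s $ j) ^ (m - 1)"
    unfolding open_dist by blast
  have xj: "0 < x $ j"
    using assms(1) by (simp add: positive_vectors_def)
  define s where "s = x $ j - min e (x $ j) / 2"
  have s: "0 < s" "s < x $ j" "dist s (x $ j) < e"
    using e(1) xj by (auto simp: s_def dist_real_def)
  show ?thesis
  proof (rule that)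
    show "g s \<in> positive_vectors" "g s $ j < x $ j" "\<And>k. k \<noteq> j \<Longrightarrow> g s $ k = x $ k"
      using assms(1) s by (auto simp: g_def positive_vectors_def)
    show "tensor_apply m A (g s) $ j < l * (g s $ j) ^ (m - 1)"
      using e(2) s(3) by blast
  qed
qed

text \<open>
  Among the minimizers of the largest ratio $(\mathcal{A} x^{m-1})_i / x_i^{m-1}$, one with the
  fewest indices attaining it is an eigenvector: otherwise some arc leaves the set of these indices,
  and decreasing the coordinate at its head slightly makes this set smaller.
\<close>

lemma positive_eigenvector:
  fixes A :: "'n::finite list \<Rightarrow> real"
  assumes "m \<ge> 2" "nonneg_tensor m A" "weakly_irreducible m A"
  obtains l u where "0 \<le> l" "u \<in> positive_vectors"
    "\<And>i. tensor_apply m A u $ i = l * (u $ i) ^ (m - 1)"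
proof -
  obtain l x where "0 \<le> l" and x: "x \<in> positive_vectors"
      "\<And>i. tensor_apply m A x $ i \<le> l * (x $ i) ^ (m - 1)"
    and l: "\<And>y. y \<in> positive_vectors \<Longrightarrow> \<exists>i. l * (y $ i) ^ (m - 1) \<le> tensor_apply m A y $ i"
    using tensor_minimax_attained[OF assms] by blast
  define P where "P y \<longleftrightarrow> y \<in> positive_vectors \<and> (\<forall>i. tensor_apply m A y $ i \<le> l * (y $ i) ^ (m - 1))" for y
  define M where "M y = {i. tensor_apply m A y $ i = l * (y $ i) ^ (m - 1)}" for y
  have "P x"
    using x by (simp add: P_def)
  then obtain u where u: "P u" "\<And>y. P y \<Longrightarrow> card (M u) \<le> card (M y)"
    using ex_has_least_nat[of P x "\<lambda>y. card (M y)"] by blast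
  have u0: "u \<in> positive_vectors" "\<And>i. tensor_apply m A u $ i \<le> l * (u $ i) ^ (m - 1)"
    using u(1) by (auto simp: P_def)
  \<comment> \<open>Some index is tight, since otherwise all ratios of \<open>u\<close> would lie
    strictly below \<open>l\<close>.\<close>
  obtain i0 where "i0 \<in> M u"
    using l[OF u0(1)] u0(2) by (force simp: M_def intro: order_antisym)
  then have "M u = UNIV"
  proof (rule weakly_irreducible_closed[OF assms(3)])
    fix i j
    assume ij: "i \<in> M u" "(i, j) \<in> parcs (tensor_digraph m A)"
    show "j \<in> M u"
    proof (rule ccontr)
      assume "j \<notin> M u"
      then have "tensor_apply m A u $ j < l * (u $ j) ^ (m - 1)"
        using u0(2)[of j] by (simp add: M_def)
      then obtain y where y: "y \<in> positive_vectors" "y $ j < u $ j" "\<And>k. k \<noteq> j \<Longrightarrow> y $ k = u $ k"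
          "tensor_apply m A y $ j < l * (y $ j) ^ (m - 1)"
        using decrease_coordinate[OF u0(1)] by blast
      have y0: "0 < y $ k" "y $ k \<le> u $ k" for k
        using y(1-3) by (auto simp: positive_vectors_def intro: less_imp_le) (metis less_imp_le order_refl)
      have le: "tensor_apply m A y $ k \<le> tensor_apply m A u $ k" for k
        using tensor_apply_le[OF assms(1,2), of k 1 y 1 u] y0 by (simp add: less_imp_le)
      have "P y"
        unfolding P_def
      proof (intro conjI allI)
        fix k
        show "tensor_apply m A y $ k \<le> l * (y $ k) ^ (m - 1)"
          using y(3,4) le[of k] u0(2)[of k] by (cases "k = j") auto
      qed (rule y)
      \<comment> \<open>Index \<open>i\<close> stops being tight because (Ay)_i < (Au)_i while
        coordinate \<open>i\<close> is unchanged; \<open>j\<close> stays slack; and any other slack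
        index stays slack, as its coordinate is unchanged and its entry of the tensor map did not
        grow.\<close>
      moreover have "M y \<subseteq> M u - {i}"
      proof
        fix k
        assume k: "k \<in> M y"
        then have kj: "k \<noteq> j"
          using y(4) by (auto simp: M_def)
        have "tensor_apply m A y $ i < tensor_apply m A u $ i"
          by (rule tensor_apply_strict_mono[OF assms(1,2) ij(2)]) (use y y0 in auto)
        moreover have "i \<noteq> j"
          using ij(1) \<open>j \<notin> M u\<close> by blast
        ultimately have "k \<noteq> i"
          using k ij(1) y(3)[of i] by (auto simp: M_def)
        then show "k \<in> M u - {i}"
          using k le[of k] u0(2)[of k] y(3)[OF kj] by (auto simp: M_def)
      qed
      then have "card (M y) < card (M u)"
        using ij(1) by (intro psubset_card_mono) auto
      ultimately show False
        using u(2) by fastforce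
    qed
  qed
  then have "tensor_apply m A u $ i = l * (u $ i) ^ (m - 1)" for i
    unfolding M_def by blast
  then show ?thesis
    using that \<open>0 \<le> l\<close> u0(1) by blast
qed

section \<open>The eigenvalue as spectral radius\<close>

lemma norm_tensor_apply_le:
  fixes A :: "'n::finite list \<Rightarrow> real" and z :: "complex ^ 'n"
  assumes "m \<ge> 2" "nonneg_tensor m A"
  shows "cmod (tensor_apply m (\<lambda>is. complex_of_real (A is)) z $ i)
    \<le> tensor_apply m A (\<chi> j. cmod (z $ j)) $ i"
proof -
  have "cmod (\<Prod>j\<leftarrow>js. z $ j) = (\<Prod>j\<leftarrow>js. cmod (z $ j))" for js
    by (induction js) (simp_all add: norm_mult)
  then have "cmod (complex_of_real (A (i # js)) * (\<Prod>j\<leftarrow>js. z $ j)) = A (i # js) * (\<Prod>j\<leftarrow>js. cmod (z $ j))"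
    if "length js = m - 1" for js
    using that assms by (simp add: norm_mult nonneg_tensor_def)
  then show ?thesis
    by (auto simp: tensor_apply_def intro!: sum_norm_le)
qed

text \<open>For an eigenpair (mu, z) take k maximizing |z_i| / u_i, with maximum t > 0. Then |mu|
  |z_k|^(m-1) <= (A|z|)_k <= t^(m-1) (Au)_k = l |z_k|^(m-1), and |z_k| > 0 can be cancelled.\<close>

lemma tensor_spectral_radius_eq:
  fixes A :: "'n::finite list \<Rightarrow> real"
  assumes "m \<ge> 2" "nonneg_tensor m A" "0 \<le> l" "u \<in> positive_vectors"
    and eig: "\<And>i. tensor_apply m A u $ i = l * (u $ i) ^ (m - 1)"
  shows "tensor_spectral_radius m A = l"
  unfolding tensor_spectral_radius_def
proof (rule Greatest_equality)
  have "(\<Prod>j\<leftarrow>js. complex_of_real (u $ j)) = complex_of_real (\<Prod>j\<leftarrow>js. u $ j)" for js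
    by (induction js) simp_all
  then have "tensor_apply m (\<lambda>is. complex_of_real (A is)) (\<chi> j. complex_of_real (u $ j)) $ i
      = complex_of_real (tensor_apply m A u $ i)" for i
    by (simp add: tensor_apply_def)
  then have "tensor_apply m (\<lambda>is. complex_of_real (A is)) (\<chi> j. complex_of_real (u $ j))
      = (\<chi> i. complex_of_real l * ((\<chi> j. complex_of_real (u $ j)) $ i) ^ (m - 1))"
    by (simp add: vec_eq_iff eig)
  moreover have "(\<chi> j. complex_of_real (u $ j)) \<noteq> 0"
    using assms(4) by (simp add: vec_eq_iff positive_vectors_def less_imp_neq[symmetric])
  ultimately have "tensor_eigenvalue m A (complex_of_real l)"
    unfolding tensor_eigenvalue_def by blast
  then show "\<exists>\<mu>. tensor_eigenvalue m A \<mu> \<and> l = cmod \<mu>"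
    using assms(3) by (intro exI[of _ "complex_of_real l"]) simp
next
  fix r
  assume "\<exists>\<mu>. tensor_eigenvalue m A \<mu> \<and> r = cmod \<mu>"
  then obtain \<mu> z where r: "r = cmod \<mu>" and "z \<noteq> 0"
    and z: "tensor_apply m (\<lambda>is. complex_of_real (A is)) z = (\<chi> i. \<mu> * (z $ i) ^ (m - 1))"
    by (auto simp: tensor_eigenvalue_def)
  have u: "0 < u $ i" for i
    using assms(4) by (simp add: positive_vectors_def)
  obtain k where k: "\<And>i. cmod (z $ i) / u $ i \<le> cmod (z $ k) / u $ k"
    using ex_is_arg_min_if_finite[of UNIV "\<lambda>i. - (cmod (z $ i) / u $ i)"]
    by (auto simp: is_arg_min_linorder)
  define t where "t = cmod (z $ k) / u $ k"
  have zt: "cmod (z $ i) \<le> t * u $ i" for i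
    using k[of i] u[of i] by (simp add: t_def[symmetric] pos_divide_le_eq)
  obtain j where "z $ j \<noteq> 0"
    using \<open>z \<noteq> 0\<close> by (auto simp: vec_eq_iff)
  then have "0 < t"
    using zt[of j] u[of j] by (metis less_le_trans norm_eq_zero norm_ge_zero order_less_le zero_less_mult_pos2)
  have "r * cmod (z $ k) ^ (m - 1) = cmod (tensor_apply m (\<lambda>is. complex_of_real (A is)) z $ k)"
    by (simp add: z r norm_mult norm_power)
  also have "\<dots> \<le> 1 ^ (m - 1) * tensor_apply m A (\<chi> j. cmod (z $ j)) $ k"
    using norm_tensor_apply_le[OF assms(1,2)] by simp
  also have "\<dots> \<le> t ^ (m - 1) * tensor_apply m A u $ k"
    by (rule tensor_apply_le[OF assms(1,2)]) (use zt in auto)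
  also have "\<dots> = l * cmod (z $ k) ^ (m - 1)"
    using u[of k] by (simp add: eig t_def power_divide)
  finally show "r \<le> l"
    using \<open>0 < t\<close> u[of k] by (auto simp: t_def zero_less_divide_iff)
qed

section \<open>Circuits and products along them\<close>

lemma circuit_along_function:
  fixes A :: "'n::finite list \<Rightarrow> real"
  assumes "\<And>i. (i, f i) \<in> parcs (tensor_digraph m A)"
  obtains \<gamma> where "\<gamma> \<in> tensor_circuits m A" "\<And>i j. (i, j) \<in> set \<gamma> \<Longrightarrow> j = f i"
proof -
  \<comment> \<open>In the functional graph of \<open>f\<close> every circuit extracted from a
    closed walk consists of arcs \<open>(i, f i)\<close> only, which a search in the full digraph
    would not guarantee.\<close>
  define H where "H = \<lparr> pverts = UNIV :: 'n set, parcs = {(i, f i) | i. True} \<rparr>"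
  have H: "pverts H = UNIV" "parcs H = {(i, f i) | i. True}"
    by (simp_all add: H_def)
  interpret H: pair_fin_digraph H
    by unfold_locales (simp_all add: H)
  have walk: "\<exists>p. H.awalk i p ((f ^^ n) i) \<and> length p = n" for i n
  proof (induction n arbitrary: i)
    case 0
    then show ?case
      by (simp add: H.awalk_Nil_iff H)
  next
    case (Suc n)
    then obtain p where "H.awalk (f i) p ((f ^^ n) (f i))" "length p = n"
      by blast
    then have "H.awalk i ((i, f i) # p) ((f ^^ Suc n) i)"
      by (simp add: H.awalk_Cons_iff H funpow_swap1)
    then show ?case
      using \<open>length p = n\<close> by (intro exI[of _ "(i, f i) # p"]) simp
  qed
  fix i0 :: 'n
  \<comment> \<open>Pigeonhole: the orbit of \<open>i0\<close> repeats and so closes up to a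
    walk.\<close>
  have "\<not> inj (\<lambda>n. (f ^^ n) i0)"
    using finite_imageD[of "\<lambda>n. (f ^^ n) i0" UNIV] infinite_UNIV_nat finite[of "range (\<lambda>n. (f ^^ n) i0)"]
    by blast
  then obtain a b where ab: "a < b" "(f ^^ a) i0 = (f ^^ b) i0"
    unfolding inj_def by (metis linorder_neqE_nat)
  define v where "v = (f ^^ a) i0"
  have "(f ^^ (b - a)) v = v"
    using ab funpow_add[of "b - a" a f] by (simp add: v_def)
  then obtain p where "H.awalk v p v" "length p = b - a"
    using walk[of v "b - a"] by auto
  then have "H.closed_w p"
    using ab(1) by (auto simp: H.closed_w_def)
  then obtain \<gamma> where \<gamma>: "H.cycle \<gamma>"
    using H.closed_w_imp_cycle by blast
  then have sub: "set \<gamma> \<subseteq> {(i, f i) | i. True}"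
    by (auto simp: H.cycle_def H.awalk_def H)
  interpret G: pair_fin_digraph "tensor_digraph m A"
    by (rule pair_fin_digraph_tensor_digraph)
  have "G.cycle \<gamma>"
    using \<gamma> sub assms unfolding H.cycle_def G.cycle_def H.awalk_def G.awalk_def
    by (auto simp: tensor_digraph_def)
  then show ?thesis
    using that sub by (auto simp: tensor_circuits_def)
qed

lemma circuit_prod_telescope:
  fixes t :: "'n::finite \<Rightarrow> real"
  assumes "\<gamma> \<in> tensor_circuits m A" "\<And>i. 0 < t i"
  shows "(\<Prod>e\<leftarrow>\<gamma>. t (snd e) / t (fst e)) = 1"
proof -
  interpret G: pair_fin_digraph "tensor_digraph m A"
    by (rule pair_fin_digraph_tensor_digraph)
  \<comment> \<open>Along an open walk the product telescopes to the quotient of its end values;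
    this is the form that admits induction.\<close>
  have cas: "(\<Prod>e\<leftarrow>p. t (snd e) / t (fst e)) = t v / t u" if "pcas u p v" for p u v
    using that
  proof (induction p arbitrary: u)
    case Nil
    then show ?case
      using assms(2)[of v] by simp
  next
    case (Cons e p)
    then have "(\<Prod>e\<leftarrow>p. t (snd e) / t (fst e)) = t v / t (snd e)" "fst e = u"
      by (cases e; auto)+
    then show ?case
      using assms(2)[of "snd e"] by simp
  qed
  obtain u where "pcas u \<gamma> u"
    using assms(1) by (auto simp: tensor_circuits_def G.cycle_def G.awalk_def)
  then show ?thesis
    using cas assms(2)[of u] by simp
qed

lemma circuit_nonempty: "\<gamma> \<in> tensor_circuits m A \<Longrightarrow> \<gamma> \<noteq> []"
  by (auto simp: tensor_circuits_def pre_digraph.cycle_def)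

text \<open>The weights \<open>(t j / t i) ^ (m - 1)\<close> multiply to 1 around the circuit, so
  they may be inserted into the product before comparing it with a power of \<open>l\<close> factor
  by factor.\<close>

lemma circuit_mean_ge:
  fixes A :: "'n::finite list \<Rightarrow> real"
  assumes "\<gamma> \<in> tensor_circuits m A" "\<And>i. 0 < t i" "0 \<le> l"
    and "\<And>i j. (i, j) \<in> set \<gamma> \<Longrightarrow> l \<le> tensor_apply m A x $ i / (x $ i) ^ (m - 1) * (t j / t i) ^ (m - 1)"
  shows "l \<le> circuit_mean m A x \<gamma>"
proof -
  have "l ^ length \<gamma> = (\<Prod>e\<leftarrow>\<gamma>. l)"
    by (simp add: prod_list_map_const)
  also have "\<dots> \<le> (\<Prod>e\<leftarrow>\<gamma>. tensor_apply m A x $ fst e / (x $ fst e) ^ (m - 1) * (t (snd e) / t (fst e)) ^ (m - 1))"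
    using assms(3,4) by (intro conjunct2[OF prod_list_map_mono]) auto
  also have "\<dots> = (\<Prod>(i, j)\<leftarrow>\<gamma>. tensor_apply m A x $ i / (x $ i) ^ (m - 1))"
    using circuit_prod_telescope[where t = t, OF assms(1,2)]
    by (simp only: prod_list_map_mult prod_list_map_power) (simp add: case_prod_unfold)
  finally have "root (length \<gamma>) (l ^ length \<gamma>) \<le> circuit_mean m A x \<gamma>"
    unfolding circuit_mean_def using circuit_nonempty[OF assms(1)] by (intro real_root_le_mono) auto
  then show ?thesis
    using circuit_nonempty[OF assms(1)] assms(3) by (simp add: real_root_power_cancel)
qed

text \<open>Dual to \<open>circuit_mean_ge\<close>. The smaller factors are now the weighted ratios,
  so it is their nonnegativity that lets the factorwise bounds be multiplied.\<close>

lemma circuit_mean_le: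
  fixes A :: "'n::finite list \<Rightarrow> real"
  assumes "\<gamma> \<in> tensor_circuits m A" "\<And>i. 0 < t i" "0 \<le> l"
    and "\<And>i. 0 \<le> tensor_apply m A x $ i / (x $ i) ^ (m - 1)"
    and "\<And>i j. (i, j) \<in> set \<gamma> \<Longrightarrow> tensor_apply m A x $ i / (x $ i) ^ (m - 1) * (t j / t i) ^ (m - 1) \<le> l"
  shows "circuit_mean m A x \<gamma> \<le> l"
proof -
  have nonneg: "0 \<le> tensor_apply m A x $ i / (x $ i) ^ (m - 1) * (t j / t i) ^ (m - 1)" for i j
    using assms(2) by (intro mult_nonneg_nonneg[OF assms(4)]) (simp add: less_imp_le)
  have "(\<Prod>(i, j)\<leftarrow>\<gamma>. tensor_apply m A x $ i / (x $ i) ^ (m - 1))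
      = (\<Prod>e\<leftarrow>\<gamma>. tensor_apply m A x $ fst e / (x $ fst e) ^ (m - 1) * (t (snd e) / t (fst e)) ^ (m - 1))"
    using circuit_prod_telescope[where t = t, OF assms(1,2)]
    by (simp only: prod_list_map_mult prod_list_map_power) (simp add: case_prod_unfold)
  also have "\<dots> \<le> (\<Prod>e\<leftarrow>\<gamma>. l)"
    using assms(5) nonneg by (intro conjunct2[OF prod_list_map_mono]) auto
  also have "\<dots> = l ^ length \<gamma>"
    by (simp add: prod_list_map_const)
  finally have "circuit_mean m A x \<gamma> \<le> root (length \<gamma>) (l ^ length \<gamma>)"
    unfolding circuit_mean_def using circuit_nonempty[OF assms(1)] by (intro real_root_le_mono) auto
  then show ?thesis
    using circuit_nonempty[OF assms(1)] assms(3) by (simp add: real_root_power_cancel)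
qed

section \<open>Circuit means compared with the eigenvalue\<close>

text \<open>A vertex without out-arcs is closed by itself, hence the only vertex; but a circuit
  contains an arc, which would have to start there.\<close>

lemma tensor_out_arc:
  fixes A :: "'n::finite list \<Rightarrow> real"
  assumes "weakly_irreducible m A" "tensor_circuits m A \<noteq> {}"
  shows "\<exists>j. (i, j) \<in> parcs (tensor_digraph m A)"
proof (rule ccontr)
  assume no: "\<not> ?thesis"
  then have "{i} = UNIV"
    by (intro weakly_irreducible_closed[OF assms(1), of i]) auto
  moreover obtain \<gamma> where \<gamma>: "\<gamma> \<in> tensor_circuits m A"
    using assms(2) by blast
  then obtain k j where "(k, j) \<in> set \<gamma>"
    using circuit_nonempty[OF \<gamma>] by (cases \<gamma>) auto
  then have "(k, j) \<in> parcs (tensor_digraph m A)"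
    using \<gamma> by (auto simp: tensor_circuits_def pre_digraph.cycle_def pre_digraph.awalk_def)
  ultimately show False
    using no by (metis UNIV_I singletonD)
qed

lemma minimal_successor:
  fixes t :: "'n::finite \<Rightarrow> real"
  assumes "\<And>i. \<exists>j. (i, j) \<in> E"
  obtains f where "\<And>i. (i, f i) \<in> E" "\<And>i j. (i, j) \<in> E \<Longrightarrow> t (f i) \<le> t j"
proof -
  have "\<exists>j. (i, j) \<in> E \<and> (\<forall>k. (i, k) \<in> E \<longrightarrow> t j \<le> t k)" for i
    using ex_is_arg_min_if_finite[of "{j. (i, j) \<in> E}" t] assms[of i]
    by (auto simp: is_arg_min_linorder)
  then show ?thesis
    using that by metis
qed

text \<open>
  For a positive eigenvector \<open>u\<close>, follow from each vertex an arc whose head has the largest (smallest)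
  ratio \<open>u\<^sub>j / x\<^sub>j\<close>; these ratios cancel around the circuit that this walk runs into.
\<close>

lemma circuit_mean_around_eigenvalue:
  fixes A :: "'n::finite list \<Rightarrow> real"
  assumes "m \<ge> 2" "nonneg_tensor m A" "weakly_irreducible m A" "tensor_circuits m A \<noteq> {}"
    and "0 \<le> l" "u \<in> positive_vectors" "x \<in> positive_vectors"
    and eig: "\<And>i. tensor_apply m A u $ i = l * (u $ i) ^ (m - 1)"
  shows "\<exists>\<gamma>\<in>tensor_circuits m A. l \<le> circuit_mean m A x \<gamma>"
    and "\<exists>\<gamma>\<in>tensor_circuits m A. circuit_mean m A x \<gamma> \<le> l"
proof -
  have u: "0 < u $ i" and x: "0 < x $ i" for i
    using assms(6,7) by (simp_all add: positive_vectors_def)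
  define t where "t i = u $ i / x $ i" for i
  have t: "0 < t i" "u $ i = t i * x $ i" for i
    using u[of i] x[of i] by (simp_all add: t_def)
  have out: "\<exists>j. (i, j) \<in> parcs (tensor_digraph m A)" for i
    by (rule tensor_out_arc[OF assms(3,4)])
  show "\<exists>\<gamma>\<in>tensor_circuits m A. l \<le> circuit_mean m A x \<gamma>"
  proof -
    obtain f where f: "\<And>i. (i, f i) \<in> parcs (tensor_digraph m A)"
        "\<And>i j. (i, j) \<in> parcs (tensor_digraph m A) \<Longrightarrow> - t (f i) \<le> - t j"
      using minimal_successor[OF out, of "\<lambda>j. - t j"] by blast
    obtain \<gamma> where \<gamma>: "\<gamma> \<in> tensor_circuits m A" "\<And>i j. (i, j) \<in> set \<gamma> \<Longrightarrow> j = f i"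
      using circuit_along_function[of f m A, OF f(1)] by blast
    have "l \<le> tensor_apply m A x $ i / (x $ i) ^ (m - 1) * (t (f i) / t i) ^ (m - 1)" for i
    proof -
      \<comment> \<open>On every out-neighbour \<open>j\<close> of \<open>i\<close>,
        \<open>u $ j = t j * x $ j\<close> is at most \<open>t (f i) * x $ j\<close>.\<close>
      have "1 ^ (m - 1) * tensor_apply m A u $ i \<le> t (f i) ^ (m - 1) * tensor_apply m A x $ i"
        by (rule tensor_apply_le[OF assms(1,2)]) (use t f(2) x in \<open>auto simp: less_imp_le\<close>)
      then show ?thesis
        using t[of i] x[of i] by (simp add: eig power_mult_distrib power_divide field_simps)
    qed
    then have "l \<le> circuit_mean m A x \<gamma>"
      using \<gamma> t(1) assms(5) by (intro circuit_mean_ge[where t = t]) blast+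
    then show ?thesis
      using \<gamma>(1) by blast
  qed
  show "\<exists>\<gamma>\<in>tensor_circuits m A. circuit_mean m A x \<gamma> \<le> l"
  proof -
    obtain f where f: "\<And>i. (i, f i) \<in> parcs (tensor_digraph m A)"
        "\<And>i j. (i, j) \<in> parcs (tensor_digraph m A) \<Longrightarrow> t (f i) \<le> t j"
      using minimal_successor[OF out, of t] by blast
    obtain \<gamma> where \<gamma>: "\<gamma> \<in> tensor_circuits m A" "\<And>i j. (i, j) \<in> set \<gamma> \<Longrightarrow> j = f i"
      using circuit_along_function[of f m A, OF f(1)] by blast
    have "tensor_apply m A x $ i / (x $ i) ^ (m - 1) * (t (f i) / t i) ^ (m - 1) \<le> l" for i
    proof -
      have "t (f i) ^ (m - 1) * tensor_apply m A x $ i \<le> 1 ^ (m - 1) * tensor_apply m A u $ i"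
        by (rule tensor_apply_le[OF assms(1,2)]) (use t f(2) x in \<open>auto simp: less_imp_le\<close>)
      then show ?thesis
        using t[of i] x[of i] by (simp add: eig power_mult_distrib power_divide field_simps)
    qed
    moreover have "0 \<le> tensor_apply m A x $ i / (x $ i) ^ (m - 1)" for i
      using x tensor_apply_nonneg[OF assms(1,2), of x i] by (simp add: less_imp_le)
    ultimately have "circuit_mean m A x \<gamma> \<le> l"
      using \<gamma> t(1) assms(5) by (intro circuit_mean_le[where t = t]) blast+
    then show ?thesis
      using \<gamma>(1) by blast
  qed
qed

theorem theorem3p5:
  fixes A :: "'n::finite list \<Rightarrow> real" and m :: nat
  assumes "m \<ge> 2"
    and "nonneg_tensor m A"
    and "weakly_irreducible m A"
    and "tensor_circuits m A \<noteq> {}"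
  shows "is_minimum {Max (circuit_mean m A x ` tensor_circuits m A) | x. x \<in> positive_vectors}
           (tensor_spectral_radius m A)
       \<and> is_maximum {Min (circuit_mean m A x ` tensor_circuits m A) | x. x \<in> positive_vectors}
           (tensor_spectral_radius m A)"
proof -
  obtain l u where l: "0 \<le> l" and u: "u \<in> positive_vectors"
    and eig: "\<And>i. tensor_apply m A u $ i = l * (u $ i) ^ (m - 1)"
    using positive_eigenvector[OF assms(1-3)] by blast
  have \<rho>: "tensor_spectral_radius m A = l"
    by (rule tensor_spectral_radius_eq[OF assms(1,2) l u eig])
  have ratio: "tensor_apply m A u $ i / (u $ i) ^ (m - 1) = l" for i
    using u by (simp add: eig positive_vectors_def less_imp_neq[symmetric])
  \<comment> \<open>All ratios of \<open>u\<close> are equal to \<open>l\<close>, so constant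
    weights give both bounds.\<close>
  have "circuit_mean m A u \<gamma> = l" if "\<gamma> \<in> tensor_circuits m A" for \<gamma>
    by (intro order_antisym circuit_mean_ge[OF that, of "\<lambda>_. 1"] circuit_mean_le[OF that, of "\<lambda>_. 1"])
      (simp_all add: ratio[simplified] l)
  then have "circuit_mean m A u ` tensor_circuits m A = {l}"
    using assms(4) by force
  then have attained: "l = Max (circuit_mean m A u ` tensor_circuits m A)"
      "l = Min (circuit_mean m A u ` tensor_circuits m A)"
    by simp_all
  have "l \<le> Max (circuit_mean m A x ` tensor_circuits m A)"
      "Min (circuit_mean m A x ` tensor_circuits m A) \<le> l" if "x \<in> positive_vectors" for x
    using circuit_mean_around_eigenvalue[OF assms l u that eig] finite_tensor_circuits[of m A] assms(4)
    by (simp_all add: Max_ge_iff Min_le_iff)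
  then show ?thesis
    unfolding is_minimum_def is_maximum_def \<rho> using attained u by blast
qed

end
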